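(* Let $\mathsf{n}=(L_1,\dots,L_n)$ be a tuple of linear subspaces of a finite-dimensional vector space $V$ over a field $\mathbb{K}$. Every circuit $\mathsf{c}$ of the Minkowski matroid $\mathsf{M}(\mathsf{n})$ satisfies $\delta(\mathsf{c})=-1$.
   Context: A tuple is a finite indexed family of linear subspaces of $V$ (repetitions allowed); a subtuple is a subfamily indexed by a subset of the index set, and unions, intersections and complements of subtuples are taken on index sets. For a tuple $\mathsf{k}$, its linear span is $\langle\mathsf{k}\rangle=\sum_{L\in\mathsf{k}}L$ (the zero space for the empty tuple), its cardinality $\mathfrak{c}(\mathsf{k})$ is the number of its entries, and its defect is $\delta(\mathsf{k})=\dim\langle\mathsf{k}\rangle-\mathfrak{c}(\mathsf{k})$. A tuple is linearly independent if every subtuple of it (including itself) has non-negative defect. The Minkowski matroid $\mathsf{M}(\mathsf{n})$ is the matroid whose ground set is the set of entries (indices) of $\mathsf{n}$ and whose independent sets are the linearly independent subtuples of $\mathsf{n}$. A circuit is a minimal (by inclusion) linearly dependent subtuple. *)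

theory Defs
  imports Complex_Main "HOL-Library.Set_Algebras"
begin

text \<open>
  A tuple of subspaces is given by a family \<open>L :: 'i \<Rightarrow> 'b set\<close> together with a finite index
  set \<open>I\<close>; entries may repeat, since \<open>L\<close> need not be injective on \<open>I\<close>.  Its subtuples are the
  pairs of the same \<open>L\<close> with subsets of \<open>I\<close>.
\<close>

text \<open>The sum is the Minkowski sum of sets; over the empty index set it is \<open>{0}\<close>.\<close>

definition tuple_span :: "('i \<Rightarrow> 'b::ab_group_add set) \<Rightarrow> 'i set \<Rightarrow> 'b set" where
  "tuple_span L I = (\<Sum>i\<in>I. L i)"

definition defect ::
    "('a::field \<Rightarrow> 'b::ab_group_add \<Rightarrow> 'b) \<Rightarrow> ('i \<Rightarrow> 'b set) \<Rightarrow> 'i set \<Rightarrow> int" where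
  "defect scale L I = int (vector_space.dim scale (tuple_span L I)) - int (card I)"

definition tuple_independent ::
    "('a::field \<Rightarrow> 'b::ab_group_add \<Rightarrow> 'b) \<Rightarrow> ('i \<Rightarrow> 'b set) \<Rightarrow> 'i set \<Rightarrow> bool" where
  "tuple_independent scale L I \<longleftrightarrow> (\<forall>J\<subseteq>I. defect scale L J \<ge> 0)"

text \<open>A matroid is represented by the pair of its ground set and its family of independent sets.\<close>

definition minkowski_matroid ::
    "('a::field \<Rightarrow> 'b::ab_group_add \<Rightarrow> 'b) \<Rightarrow> ('i \<Rightarrow> 'b set) \<Rightarrow> 'i set \<Rightarrow> 'i set \<times> 'i set set"
  where
  "minkowski_matroid scale L I = (I, {J. J \<subseteq> I \<and> tuple_independent scale L J})"

definition matroid_circuit :: "'i set \<times> 'i set set \<Rightarrow> 'i set \<Rightarrow> bool" where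
  "matroid_circuit M c \<longleftrightarrow>
     c \<subseteq> fst M \<and> c \<notin> snd M \<and> (\<forall>d. d \<subset> c \<longrightarrow> d \<in> snd M)"

lemma (in vector_space) tuple_span_eq_span_Union:
  assumes "finite I" and "\<And>i. i \<in> I \<Longrightarrow> subspace (L i)"
  shows "tuple_span L I = span (\<Union>i\<in>I. L i)"
  using assms
proof (induction I rule: finite_induct)
  case empty
  then show ?case by (simp add: tuple_span_def set_zero)
next
  case (insert i I)
  have "tuple_span L (insert i I) = L i + span (\<Union>i\<in>I. L i)"
    using insert by (simp add: tuple_span_def)
  also have "\<dots> = span (L i) + span (\<Union>i\<in>I. L i)"
    using insert.prems by (simp add: span_eq_iff[THEN iffD2])
  also have "\<dots> = span (\<Union>i\<in>insert i I. L i)"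
    by (auto simp: span_Un set_plus_def)
  finally show ?case .
qed

end

theory Submission
  imports Defs
begin

text \<open>The defect of a circuit \<open>c\<close> is squeezed between two bounds. It is negative,
  since the dependence of \<open>c\<close> cannot come from a proper subtuple
  (\<open>circuit_defect_neg\<close>). It is at least -1, since deleting an entry leaves an
  independent tuple, of defect at least 0, and restoring the entry costs at most 1
  (\<open>defect_remove\<close>).\<close>

lemma (in finite_dimensional_vector_space) dim_tuple_span_mono:
  assumes "finite I" and "\<And>i. i \<in> I \<Longrightarrow> subspace (L i)" and "J \<subseteq> I"
  shows "dim (tuple_span L J) \<le> dim (tuple_span L I)"
proof -
  have "span (\<Union>i\<in>J. L i) \<subseteq> span (\<Union>i\<in>I. L i)"
    using assms(3) by (intro span_mono) auto
  moreover have "tuple_span L J = span (\<Union>i\<in>J. L i)"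
    using assms by (intro tuple_span_eq_span_Union) (auto intro: finite_subset)
  \<comment> \<open>Finite dimension enters here: \<open>dim\<close> is the \<open>card\<close> of a
    basis, which would be 0 for an infinite one.\<close>
  ultimately show ?thesis
    using assms(1,2) by (metis dim_subset tuple_span_eq_span_Union)
qed

text \<open>Deleting an entry lowers the cardinality by exactly 1 and cannot raise the dimension of
  the span.\<close>

lemma (in finite_dimensional_vector_space) defect_remove:
  assumes "finite I" and "\<And>i. i \<in> I \<Longrightarrow> subspace (L i)" and "i \<in> I"
  shows "defect scale L (I - {i}) - 1 \<le> defect scale L I"
proof -
  have "card I = Suc (card (I - {i}))"
    using assms(1,3) by (rule card.remove[THEN trans]) simp
  then show ?thesis
    using dim_tuple_span_mono[of I L "I - {i}"] assms(1,2) by (auto simp: defect_def)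
qed

text \<open>This guarantees that a circuit has an entry to delete.\<close>

lemma (in vector_space) defect_empty: "defect scale L {} = 0"
proof -
  have "tuple_span L {} = span {}"
    using tuple_span_eq_span_Union[of "{}" L] by simp
  then show ?thesis
    using dim_eq_card_independent[OF independent_empty] by (simp only: defect_def dim_span) simp
qed

lemma circuit_defect_neg:
  assumes "matroid_circuit (minkowski_matroid scale L I) c"
  shows "defect scale L c < 0"
proof -
  have "c \<subseteq> I" and "\<not> tuple_independent scale L c"
    and min: "\<And>d. d \<subset> c \<Longrightarrow> tuple_independent scale L d"
    using assms by (auto simp: matroid_circuit_def minkowski_matroid_def)
  then obtain J where "J \<subseteq> c" and "defect scale L J < 0"
    by (auto simp: tuple_independent_def not_le)
  \<comment> \<open>Minimality of \<open>c\<close> would make a proper \<open>J\<close> independent,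
    and independence includes the defect of \<open>J\<close> itself. Hence
    \<open>J = c\<close>.\<close>
  moreover have "\<not> J \<subset> c"
    using min[of J] \<open>defect scale L J < 0\<close> by (meson leD subset_refl tuple_independent_def)
  ultimately show ?thesis
    by (metis psubsetI)
qed

theorem theorem1p17:
  fixes scale :: "'a::field \<Rightarrow> 'b::ab_group_add \<Rightarrow> 'b"
    and Basis :: "'b set"
    and n :: nat
    and L :: "nat \<Rightarrow> 'b set"
    and c :: "nat set"
  assumes "finite_dimensional_vector_space scale Basis"
    and "\<forall>i\<in>{1..n}. module.subspace scale (L i)"
    and "matroid_circuit (minkowski_matroid scale L {1..n}) c"
  shows "defect scale L c = -1"
proof -
  interpret finite_dimensional_vector_space scale Basis
    by fact
  have neg: "defect scale L c < 0"
    using assms(3) by (rule circuit_defect_neg)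
  then obtain i where "i \<in> c"
    using defect_empty[of L] by force
  have "c \<subseteq> {1..n}"
    using assms(3) by (simp add: matroid_circuit_def minkowski_matroid_def)
  then have "defect scale L (c - {i}) - 1 \<le> defect scale L c"
    using assms(2) \<open>i \<in> c\<close> by (intro defect_remove) (auto intro: finite_subset)
  moreover have "tuple_independent scale L (c - {i})"
    using assms(3) \<open>i \<in> c\<close> by (auto simp: matroid_circuit_def minkowski_matroid_def)
  \<comment> \<open>Independence is applied to the whole of \<open>c - {i}\<close>. The integer
    defect of \<open>c\<close> then lies in [-1, 0).\<close>
  then have "0 \<le> defect scale L (c - {i})"
    by (simp add: tuple_independent_def)
  ultimately show ?thesis
    using neg by linarith
qed

end
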